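(* Let $X,Y$ be Banach spaces over the same field $\mathbb{K}\in\{\mathbb{R},\mathbb{C}\}$, and let $A:X\to Y$ be a continuous linear operator with $\mathrm{Im}(A)=Y$. Let $\Lambda$ be a nonempty set and let $X_\lambda$, $\lambda\in\Lambda$, be closed linear subspaces of $X$. If $(X_\lambda)_{\lambda\in\Lambda}$ is an absolutely representing family of subspaces (ARFS) in $X$, then the family $(\overline{A(X_\lambda)})_{\lambda\in\Lambda}$ is an ARFS in $Y$, where $\overline{A(X_\lambda)}$ denotes the closure of $A(X_\lambda)$ in $Y$.
   Context: A family $(X_\lambda)_{\lambda\in\Lambda}$ of closed linear subspaces of a Banach space $X$ is called an absolutely representing family of subspaces (ARFS) in $X$ if for every $x\in X$ there exist $x_\lambda\in X_\lambda$, $\lambda\in\Lambda$, such that $\sum_{\lambda\in\Lambda}\|x_\lambda\|<\infty$ and $x=\sum_{\lambda\in\Lambda}x_\lambda$. *)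

theory Defs
  imports "HOL-Analysis.Analysis"
begin

text \<open>
  The scalar fields of the theory: up to isometric isomorphism the instances of this class are
  exactly the real and the complex numbers (the multiplicative norm extending the absolute value
  of the reals is unique).
\<close>

class real_or_complex_field = real_normed_field +
  assumes real_or_complex:
    "(\<forall>z. \<exists>a. z = a *\<^sub>R 1) \<or>
     (\<exists>i. i * i = - 1 \<and> (\<forall>z. \<exists>a b. z = a *\<^sub>R 1 + b *\<^sub>R i))"

instance real :: real_or_complex_field
  by standard auto

instance complex :: real_or_complex_field
proof
  have "z = Re z *\<^sub>R 1 + Im z *\<^sub>R \<i>" for z :: complex
    by (simp add: complex_eq_iff)
  then have "\<i> * \<i> = - 1 \<and> (\<forall>z::complex. \<exists>a b. z = a *\<^sub>R 1 + b *\<^sub>R \<i>)"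
    using i_squared by blast
  then show "(\<forall>z::complex. \<exists>a. z = a *\<^sub>R 1) \<or>
      (\<exists>i::complex. i * i = - 1 \<and> (\<forall>z. \<exists>a b. z = a *\<^sub>R 1 + b *\<^sub>R i))"
    by blast
qed

text \<open>
  A Banach space over such a field is a type of class \<^class>\<open>banach\<close> (which carries the
  addition, the complete norm and the real scalar multiplication) together with a scalar
  multiplication by the field that extends the real one.
\<close>

locale banach_space = vector_space scale
  for scale :: "'k::real_or_complex_field \<Rightarrow> 'x::banach \<Rightarrow> 'x" +
  assumes norm_scale: "norm (scale c x) = norm c * norm x"
    and scale_of_real: "scale (of_real r) x = r *\<^sub>R x"
begin

definition closed_subspace :: "'x set \<Rightarrow> bool" where
  "closed_subspace S \<longleftrightarrow> subspace S \<and> closed S"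

definition ARFS :: "'l set \<Rightarrow> ('l \<Rightarrow> 'x set) \<Rightarrow> bool" where
  "ARFS \<Lambda> S \<longleftrightarrow>
    (\<forall>l\<in>\<Lambda>. closed_subspace (S l)) \<and>
    (\<forall>v. \<exists>x. (\<forall>l\<in>\<Lambda>. x l \<in> S l) \<and> (\<lambda>l. norm (x l)) summable_on \<Lambda> \<and> (x has_sum v) \<Lambda>)"

end

lemma banach_space_real: "banach_space (scaleR :: real \<Rightarrow> 'x::banach \<Rightarrow> 'x)"
  by unfold_locales (auto simp: scaleR_add_right scaleR_add_left)

lemma banach_space_complex: "banach_space ((*) :: complex \<Rightarrow> complex \<Rightarrow> complex)"
  by unfold_locales (auto simp: algebra_simps norm_mult scaleR_conv_of_real)

end

theory Submission imports Defs begin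

text \<open>Surjectivity lifts a given y to some v with A v = y. An absolutely convergent
  decomposition of v along the X l is then pushed forward term by term. Since A is bounded
  (\<open>continuous_linear_imp_bounded_linear\<close>), the norms of the images are dominated by a
  constant multiple of a summable family, and A commutes with the sum, so the images add up to y.
  The terms already lie in A(X l); the closure only serves to make the members of the new family
  closed, and it stays a subspace because the vector operations are continuous
  (\<open>closed_subspace_closure\<close>).\<close>

lemma continuous_linear_imp_bounded_linear:
  fixes f :: "'a::real_normed_vector \<Rightarrow> 'b::real_normed_vector"
  assumes lin: "linear f" and cont: "isCont f 0"
  shows "bounded_linear f"
proof -
  interpret linear f by (rule lin)
  obtain d where d: "d > 0" and less: "\<And>x. norm x < d \<Longrightarrow> norm (f x) < 1"
    using cont unfolding continuous_at_eps_delta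
    by (metis dist_norm diff_zero zero zero_less_one)
  have "norm (f x) \<le> norm x * (2 / d)" for x
  proof (cases "x = 0")
    case True
    then show ?thesis by (simp add: zero)
  next
    case False
    \<comment> \<open>Rescaling by t moves x to norm d / 2, inside the ball where f has norm below
      1. Homogeneity then gives norm (f x) < 1 / t = norm x * (2 / d).\<close>
    define t where "t = d / (2 * norm x)"
    have t: "t > 0" using False d by (simp add: t_def)
    have "norm (t *\<^sub>R x) < d" using False d by (simp add: t_def)
    then have "norm (f (t *\<^sub>R x)) < 1" by (rule less)
    then have "t * norm (f x) < 1" using t by (simp add: scale)
    then show ?thesis using False d by (simp add: t_def field_simps)
  qed
  then show ?thesis
    by (intro bounded_linear_intro[where K = "2 / d"]) (simp_all only: add scale)
qed

context banach_space
begin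

text \<open>Real scalars act through the field, so they commute with the action of c. This supplies
  the continuity of scaling by a fixed c that is needed to pass to limits in closures.\<close>

lemma bounded_linear_scale: "bounded_linear (scale c)"
proof (rule bounded_linear_intro[where K = "norm c"])
  show "scale c (r *\<^sub>R x) = r *\<^sub>R scale c x" for r x
    by (simp add: scale_left_commute flip: scale_of_real)
qed (simp_all add: scale_right_distrib norm_scale mult.commute)

text \<open>Points of the closure are limits of sequences in S; sums and multiples of such sequences
  stay in S and converge to the sum or multiple of the limits.\<close>

lemma closed_subspace_closure:
  assumes "subspace S"
  shows "closed_subspace (closure S)"
  unfolding closed_subspace_def
proof
  have "0 \<in> closure S"
    using subspace_0[OF assms] closure_subset by blast
  moreover have "x + y \<in> closure S" if "x \<in> closure S" "y \<in> closure S" for x y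
  proof -
    obtain u v where "\<forall>n. u n \<in> S" "u \<longlonglongrightarrow> x" "\<forall>n. v n \<in> S" "v \<longlonglongrightarrow> y"
      using \<open>x \<in> closure S\<close> \<open>y \<in> closure S\<close> unfolding closure_sequential by blast
    then have "\<forall>n. u n + v n \<in> S" "(\<lambda>n. u n + v n) \<longlonglongrightarrow> x + y"
      using subspace_add[OF assms] by (auto intro: tendsto_add)
    then show ?thesis unfolding closure_sequential by (intro exI conjI)
  qed
  moreover have "scale c x \<in> closure S" if "x \<in> closure S" for c x
  proof -
    obtain u where "\<forall>n. u n \<in> S" "u \<longlonglongrightarrow> x"
      using \<open>x \<in> closure S\<close> unfolding closure_sequential by blast
    then have "\<forall>n. scale c (u n) \<in> S" "(\<lambda>n. scale c (u n)) \<longlonglongrightarrow> scale c x"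
      using subspace_scale[OF assms] bounded_linear.tendsto[OF bounded_linear_scale] by auto
    then show ?thesis unfolding closure_sequential by (intro exI conjI)
  qed
  ultimately show "subspace (closure S)"
    unfolding subspace_def by blast
qed simp

end

theorem proposition3p1:
  fixes scaleX :: "'k::real_or_complex_field \<Rightarrow> 'x::banach \<Rightarrow> 'x"
    and scaleY :: "'k \<Rightarrow> 'y::banach \<Rightarrow> 'y"
    and A :: "'x \<Rightarrow> 'y"
    and \<Lambda> :: "'l set"
    and X :: "'l \<Rightarrow> 'x set"
  assumes "banach_space scaleX"
    and "banach_space scaleY"
    and "Vector_Spaces.linear scaleX scaleY A"
    and "continuous_on UNIV A"
    and "range A = UNIV"
    and "\<Lambda> \<noteq> {}"
    and "\<forall>l\<in>\<Lambda>. banach_space.closed_subspace scaleX (X l)"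
    and "banach_space.ARFS scaleX \<Lambda> X"
  shows "banach_space.ARFS scaleY \<Lambda> (\<lambda>l. closure (A ` X l))"
proof -
  interpret X: banach_space scaleX by (rule assms)
  interpret Y: banach_space scaleY by (rule assms)
  interpret A: Vector_Spaces.linear scaleX scaleY A by (rule assms)
  \<comment> \<open>Linearity over the field restricts to linearity over the reals, because both
    scalar multiplications extend the real one. This makes A a bounded linear map in the real sense,
    to which the results on \<open>has_sum\<close> apply.\<close>
  have "linear A"
    by (rule linearI) (simp_all add: A.add A.scale flip: X.scale_of_real Y.scale_of_real)
  moreover have "isCont A 0"
    using assms(4) by (simp add: continuous_on_eq_continuous_at)
  ultimately have bl: "bounded_linear A"
    by (rule continuous_linear_imp_bounded_linear)
  show ?thesis
    unfolding Y.ARFS_def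
  proof (intro conjI ballI allI)
    fix l assume "l \<in> \<Lambda>"
    then have "X.subspace (X l)"
      using assms(7) X.closed_subspace_def by blast
    then show "Y.closed_subspace (closure (A ` X l))"
      by (intro Y.closed_subspace_closure A.subspace_image)
  next
    fix y
    obtain v where y: "y = A v"
      using assms(5) by blast
    obtain x where x: "\<forall>l\<in>\<Lambda>. x l \<in> X l" "(\<lambda>l. norm (x l)) summable_on \<Lambda>" "(x has_sum v) \<Lambda>"
      using assms(8) unfolding X.ARFS_def by blast
    obtain K where K: "\<And>x. norm (A x) \<le> norm x * K"
      using bounded_linear.bounded[OF bl] by blast
    have "\<forall>l\<in>\<Lambda>. A (x l) \<in> closure (A ` X l)"
      using x(1) closure_subset by blast
    moreover have "(\<lambda>l. norm (A (x l))) summable_on \<Lambda>"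
      \<comment> \<open>The dominating family is norm (x l) * K, with K a bound for A.\<close>
      by (rule summable_on_comparison_test[OF summable_on_cmult_left[OF x(2)]]) (auto intro: K)
    moreover have "((\<lambda>l. A (x l)) has_sum y) \<Lambda>"
      using has_sum_bounded_linear[OF bl x(3)] y by (simp add: o_def)
    ultimately show "\<exists>x. (\<forall>l\<in>\<Lambda>. x l \<in> closure (A ` X l)) \<and>
        (\<lambda>l. norm (x l)) summable_on \<Lambda> \<and> (x has_sum y) \<Lambda>"
      by (intro exI[of _ "\<lambda>l. A (x l)"] conjI)
  qed
qed

end
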